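(* Let $\ell,n$ be positive integers and let $M=(m_{ab})$ be an $\ell\times \ell$ real rooted matrix. Let $C=(c_{ij})$ be an $n\times n$ nonnegative real matrix, and suppose there is a partition $\Pi=(\pi_1,\pi_2,\ldots,\pi_\ell)$ of $[n]=\{1,\ldots,n\}$ such that $$\max_{i\in \pi_a} \sum_{j\in \pi_b} c_{ij}\leq m_{ab} \quad \text{and} \quad \max_{i\in \pi_a} \sum_{j=1}^n c_{ij}\leq \sum_{c=1}^\ell m_{ac}$$ for all $1\leq a\leq \ell$ and $1\leq b\leq \ell-1$. Then $\rho(C)\leq \rho_r(M)$. Moreover, let $u=(u_1,\ldots,u_\ell)^T$ be a rooted eigenvector of $M$ for the eigenvalue $\rho_r(M)$. If $C$ is irreducible, then $\rho(C)=\rho_r(M)$ if and only if both of the following hold: (a) if $u_\ell\neq 0$, then $\sum_{j=1}^n c_{ij}=\sum_{c=1}^\ell m_{ac}$ for all $1\leq a\leq \ell$ and all $i\in\pi_a$; (b) $\sum_{j\in\pi_b} c_{ij}=m_{ab}$ for all $1\leq a\leq \ell$, $1\leq b\leq \ell-1$ and $i\in\pi_a$ such that $u_b>u_\ell$.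
   Context: For a real square matrix $C$, $\rho(C)=\max\{|\lambda|:\lambda \text{ an eigenvalue of } C\}$ is its spectral radius, and $\rho_r(C)$ denotes the largest real eigenvalue of $C$ (with $\rho_r(C)=\infty$ if $C$ has no real eigenvalue). A real vector $(v_1,\ldots,v_k)$ is called rooted if $v_i\geq v_k\geq 0$ for all $1\leq i\leq k-1$. A $k\times k$ real matrix $M$ is called rooted if there is a real constant $d$ such that each of the first $k-1$ columns of $M+dI_k$ is a rooted vector and the row-sum vector of $M+dI_k$ (the vector of its row sums) is a rooted vector. Partitions have nonempty parts. *)

theory Defs
  imports
    "Jordan_Normal_Form.Spectral_Radius"
    "HOL-Library.Extended_Real"
    "HOL-Library.Disjoint_Sets"
    "HOL-Combinatorics.Permutations"
begin

text \<open>Matrices and vectors are indexed from 0: the index set \<open>{1, \<dots>, k}\<close> becomes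
  \<open>{0..<k}\<close>, and the distinguished last index \<open>k\<close> becomes \<open>k - 1\<close>.\<close>

text \<open>The eigenvalues of a real matrix relevant for its spectral radius are the complex ones.\<close>

definition real_spectral_radius :: "real mat \<Rightarrow> real" where
  "real_spectral_radius C = spectral_radius (map_mat complex_of_real C)"

definition largest_real_eigenvalue :: "real mat \<Rightarrow> ereal" where
  "largest_real_eigenvalue C =
     (if spectrum C = {} then \<infinity> else ereal (Max (spectrum C)))"

definition rooted_vec :: "real vec \<Rightarrow> bool" where
  "rooted_vec v \<longleftrightarrow>
     (\<forall>i < dim_vec v - 1. v $ i \<ge> v $ (dim_vec v - 1)) \<and> v $ (dim_vec v - 1) \<ge> 0"

definition row_sum_vec :: "real mat \<Rightarrow> real vec" where
  "row_sum_vec M = vec (dim_row M) (\<lambda>i. \<Sum>j<dim_col M. M $$ (i, j))"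

definition rooted_mat :: "real mat \<Rightarrow> bool" where
  "rooted_mat M \<longleftrightarrow> square_mat M \<and>
     (\<exists>d::real. let M' = M + d \<cdot>\<^sub>m 1\<^sub>m (dim_row M) in
        (\<forall>j < dim_row M - 1. rooted_vec (col M' j)) \<and> rooted_vec (row_sum_vec M'))"

definition indexed_partition :: "nat \<Rightarrow> nat \<Rightarrow> (nat \<Rightarrow> nat set) \<Rightarrow> bool" where
  "indexed_partition n l \<pi> \<longleftrightarrow>
     (\<forall>a<l. \<pi> a \<noteq> {}) \<and> disjoint_family_on \<pi> {..<l} \<and> (\<Union>a<l. \<pi> a) = {..<n}"

text \<open>A square matrix is reducible if a simultaneous permutation of its rows and columns makes
  it block upper triangular with two nonempty square diagonal blocks, the first one of size \<open>k\<close>.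
  Every \<open>1 \<times> 1\<close> matrix, including the zero matrix, is irreducible in this sense.\<close>

definition reducible_mat :: "real mat \<Rightarrow> bool" where
  "reducible_mat C \<longleftrightarrow>
     (\<exists>p k. p permutes {..<dim_row C} \<and> 0 < k \<and> k < dim_row C \<and>
        (\<forall>i \<in> {k..<dim_row C}. \<forall>j<k. C $$ (p i, p j) = 0))"

definition irreducible_mat :: "real mat \<Rightarrow> bool" where
  "irreducible_mat C \<longleftrightarrow> square_mat C \<and> \<not> reducible_mat C"

end

theory Submission
  imports Defs
begin

text \<open>
  In the basis consisting of all unit vectors but the last one and of \<open>(1, \<dots>, 1)\<close>, the rooted
  vectors form the nonnegative orthant and a rooted matrix becomes a matrix \<open>K\<close> with nonnegative
  off-diagonal entries. The infimum \<open>\<mu>\<close> of all \<open>c\<close> with \<open>K x < c x\<close> for some \<open>x > 0\<close> is an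
  eigenvalue of \<open>K\<close>: otherwise \<open>(\<mu> - K) y = (1, \<dots>, 1)\<close> has a solution \<open>y\<close>, and \<open>(c - K) y > 0\<close>
  for all \<open>c\<close> close to \<open>\<mu>\<close>. For some \<open>c > \<mu>\<close> this forces \<open>y > 0\<close> by the maximum principle; but
  then \<open>y\<close> shows that some \<open>c < \<mu>\<close> is also admissible. So for every \<open>c\<close> above the largest real
  eigenvalue of \<open>M\<close> there is a positive rooted \<open>v\<close> with \<open>M v < c v\<close>. Summation by parts shows
  that its blockwise constant lift \<open>w\<close> satisfies \<open>C w < c w\<close>, whence \<open>\<rho>(C) < c\<close>.

  For the equality case, let \<open>w\<close> be the lift of \<open>u\<close>, so that \<open>C w \<le> r w\<close>, and let \<open>z\<close> consist of
  the absolute values of an eigenvector of \<open>C\<close> for an eigenvalue of modulus \<open>r = \<rho>(C)\<close>, so that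
  \<open>C z \<ge> r z\<close>. For the least \<open>t\<close> with \<open>z \<le> t w\<close> the vector \<open>t w - z\<close> has a zero entry, hence
  vanishes by irreducibility. Thus \<open>C w = r w\<close>, which is equality in every term of the summation
  by parts.
\<close>

lemma index_mult_mat_vec_sum:
  fixes A :: "'a::semiring_0 mat"
  assumes "A \<in> carrier_mat m n" "v \<in> carrier_vec n" "i < m"
  shows "(A *\<^sub>v v) $ i = (\<Sum>j<n. A $$ (i, j) * v $ j)"
  using assms by (auto simp: scalar_prod_def lessThan_atLeast0)

declare index_mult_mat_vec [simp del]

lemma nonneg_vecD:
  assumes "0\<^sub>v n \<le> v"
  shows "v \<in> carrier_vec n" and "i < n \<Longrightarrow> 0 \<le> v $ i"
  using assms by (auto simp: less_eq_vec_def)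

lemma nonneg_matD:
  assumes "0\<^sub>m m n \<le> A"
  shows "A \<in> carrier_mat m n" and "i < m \<Longrightarrow> j < n \<Longrightarrow> 0 \<le> A $$ (i, j)"
  using assms by (auto simp: less_eq_mat_def)

lemma obtain_max_ratio:
  fixes x y :: "'a \<Rightarrow> 'b::linordered_field"
  assumes "finite I" "I \<noteq> {}" and pos: "\<And>i. i \<in> I \<Longrightarrow> 0 < x i"
  obtains t i where "i \<in> I" "y i = t * x i" "\<And>j. j \<in> I \<Longrightarrow> y j \<le> t * x j"
proof -
  define t where "t = Max ((\<lambda>i. y i / x i) ` I)"
  have "t \<in> (\<lambda>i. y i / x i) ` I"
    unfolding t_def using assms by (intro Max_in) auto
  then obtain i where maximal: "i \<in> I" "t = y i / x i" by blast
  have "y j \<le> t * x j" if "j \<in> I" for j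
  proof -
    have "y j / x j \<le> t" unfolding t_def using \<open>finite I\<close> that by (intro Max_ge) auto
    then show ?thesis using pos[OF that] by (simp add: divide_le_eq)
  qed
  moreover have "y i = t * x i" using maximal pos[of i] by simp
  ultimately show ?thesis using that maximal(1) by blast
qed

lemma solution_if_not_eigenvalue:
  fixes A :: "'a::field mat"
  assumes A: "A \<in> carrier_mat n n" and b: "b \<in> carrier_vec n" and "\<not> eigenvalue A k"
  obtains y where "y \<in> carrier_vec n" "A *\<^sub>v y + b = k \<cdot>\<^sub>v y"
proof -
  let ?D = "char_matrix A k"
  have D: "?D \<in> carrier_mat n n" using A by simp
  have "det ?D \<noteq> 0" using assms(3) eigenvalue_det[OF A] by blast
  then obtain B where B: "B \<in> carrier_mat n n" "?D * B = 1\<^sub>m n"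
    using det_non_zero_imp_unit[OF D, of n] by (auto simp: Units_def ring_mat_def)
  define y where "y = B *\<^sub>v (- b)"
  have y: "y \<in> carrier_vec n" using B b by (simp add: y_def)
  have "A *\<^sub>v y - k \<cdot>\<^sub>v y = ?D *\<^sub>v y"
    using A y by (intro eq_vecI)
      (auto simp: char_matrix_def index_mult_mat_vec add_scalar_prod_distrib[of _ n]
        row_add row_smult)
  also have "\<dots> = ?D * B *\<^sub>v (- b)"
    unfolding y_def using D B(1) b by (simp add: assoc_mult_mat_vec)
  also have "\<dots> = - b" using B b by simp
  finally have diff: "A *\<^sub>v y - k \<cdot>\<^sub>v y = - b" .
  have "A *\<^sub>v y + b = k \<cdot>\<^sub>v y"
  proof (rule eq_vecI)
    fix i assume "i < dim_vec (k \<cdot>\<^sub>v y)"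
    then have "i < n" using y by simp
    then show "(A *\<^sub>v y + b) $ i = (k \<cdot>\<^sub>v y) $ i"
      using arg_cong[OF diff, of "\<lambda>v. v $ i"] A y b by (simp add: algebra_simps)
  qed (use A y b in auto)
  then show ?thesis using y that by blast
qed

section \<open>Metzler matrices and strict supersolutions\<close>

definition metzler_mat :: "'a::{zero, ord} mat \<Rightarrow> bool" where
  "metzler_mat A \<longleftrightarrow>
     square_mat A \<and> (\<forall>i<dim_row A. \<forall>j<dim_row A. i \<noteq> j \<longrightarrow> 0 \<le> A $$ (i, j))"

definition strict_supersolution :: "'a::linordered_field mat \<Rightarrow> 'a \<Rightarrow> 'a vec \<Rightarrow> bool" where
  "strict_supersolution A c x \<longleftrightarrow> x \<in> carrier_vec (dim_row A) \<and>
     (\<forall>i<dim_row A. 0 < x $ i \<and> (A *\<^sub>v x) $ i < c * x $ i)"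

lemma strict_supersolutionD:
  assumes "A \<in> carrier_mat n n" "strict_supersolution A c x"
  shows "x \<in> carrier_vec n" and "i < n \<Longrightarrow> 0 < x $ i"
    and "i < n \<Longrightarrow> (A *\<^sub>v x) $ i < c * x $ i" and "0\<^sub>v n \<le> x"
  using assms by (auto simp: strict_supersolution_def less_eq_vec_def less_imp_le)

lemma strict_supersolution_mono:
  assumes "strict_supersolution A c x" "c \<le> c'"
  shows "strict_supersolution A c' x"
  using assms unfolding strict_supersolution_def
  by (meson less_imp_le less_le_trans mult_right_mono)

lemma ex_strict_supersolution:
  fixes A :: "'a::linordered_field mat"
  assumes A: "A \<in> carrier_mat n n"
  shows "\<exists>c x. strict_supersolution A c x"
proof -
  let ?row_sum = "\<lambda>i. \<Sum>j<n. A $$ (i, j)"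
  have "?row_sum i < 1 + (\<Sum>k<n. \<bar>?row_sum k\<bar>)" if "i < n" for i
  proof -
    have "?row_sum i \<le> \<bar>?row_sum i\<bar>" by (rule abs_ge_self)
    also have "\<dots> \<le> (\<Sum>k<n. \<bar>?row_sum k\<bar>)" using that by (intro member_le_sum) auto
    finally show ?thesis by simp
  qed
  then have "strict_supersolution A (1 + (\<Sum>k<n. \<bar>?row_sum k\<bar>)) (vec n (\<lambda>_. 1))"
    using A by (auto simp: strict_supersolution_def index_mult_mat_vec_sum[OF A]
       )
  then show ?thesis by blast
qed

lemma metzler_diag_le:
  fixes A :: "'a::linordered_field mat"
  assumes A: "A \<in> carrier_mat n n" "metzler_mat A" and x: "0\<^sub>v n \<le> x" and "i < n"
  shows "A $$ (i, i) * x $ i \<le> (A *\<^sub>v x) $ i"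
proof -
  have "(A *\<^sub>v x) $ i = A $$ (i, i) * x $ i + (\<Sum>j\<in>{..<n} - {i}. A $$ (i, j) * x $ j)"
    using index_mult_mat_vec_sum[OF A(1) nonneg_vecD(1)[OF x] \<open>i < n\<close>] \<open>i < n\<close>
    by (simp add: sum.remove)
  moreover have "0 \<le> (\<Sum>j\<in>{..<n} - {i}. A $$ (i, j) * x $ j)"
    using A \<open>i < n\<close> nonneg_vecD(2)[OF x] by (intro sum_nonneg) (auto simp: metzler_mat_def)
  ultimately show ?thesis by simp
qed

lemma metzler_supersolution_nonneg:
  fixes A :: "'a::linordered_field mat"
  assumes A: "A \<in> carrier_mat n n" "metzler_mat A"
    and x: "strict_supersolution A c x" and y: "A *\<^sub>v y \<le> c \<cdot>\<^sub>v y"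
  shows "0\<^sub>v n \<le> y"
proof (rule ccontr)
  assume neg: "\<not> 0\<^sub>v n \<le> y"
  note x_bounds = strict_supersolutionD[OF A(1) x]
  have y_carrier: "y \<in> carrier_vec n" using y A(1) by (auto simp: less_eq_vec_def)
  then obtain k where k: "k < n" "y $ k < 0"
    using neg by (auto simp: less_eq_vec_def not_le)
  obtain t i where touch: "i < n" "- y $ i = t * x $ i"
    and above: "\<And>j. j < n \<Longrightarrow> - y $ j \<le> t * x $ j"
    using obtain_max_ratio[of "{..<n}" "\<lambda>i. x $ i" "\<lambda>i. - y $ i"] x_bounds(2) k(1)
    by (metis emptyE finite_lessThan lessThan_iff)
  have "0 < t * x $ k" using above[OF k(1)] k(2) by simp
  then have "0 < t" using x_bounds(2)[OF k(1)] by (simp add: zero_less_mult_iff)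
  define z where "z = t \<cdot>\<^sub>v x + y"
  have "0 \<le> z $ j" if "j < n" for j
    using above[OF that] x_bounds(1) y_carrier that by (simp add: z_def minus_le_iff add.commute)
  then have z: "0\<^sub>v n \<le> z" "z $ i = 0"
    using touch x_bounds(1) y_carrier by (auto simp: z_def less_eq_vec_def simp flip: touch(2))
  have "0 \<le> (A *\<^sub>v z) $ i"
    using metzler_diag_le[OF A z(1) touch(1)] z(2) by simp
  also have "\<dots> = t * (A *\<^sub>v x) $ i + (A *\<^sub>v y) $ i"
    using A(1) x_bounds(1) y_carrier touch(1)
    by (simp add: z_def mult_add_distrib_mat_vec[OF A(1)] mult_mat_vec[OF A(1)])
  also have "\<dots> < t * (c * x $ i) + c * y $ i"
    using x_bounds(3)[OF touch(1)] y touch(1) y_carrier \<open>0 < t\<close>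
    by (intro add_less_le_mono mult_strict_left_mono) (auto simp: less_eq_vec_def)
  also have "\<dots> = c * (t * x $ i + y $ i)" by (simp add: algebra_simps)
  finally show False using touch(2) by (metis add.left_inverse less_irrefl mult_zero_right)
qed

lemma metzler_ex_smaller_strict_supersolution:
  fixes A :: "'a::linordered_field mat"
  assumes A: "A \<in> carrier_mat n n" "metzler_mat A"
    and "\<And>c. \<mu> < c \<Longrightarrow> \<exists>x. strict_supersolution A c x" and "\<not> eigenvalue A \<mu>"
  shows "\<exists>c<\<mu>. \<exists>x. strict_supersolution A c x"
proof -
  obtain y where y: "y \<in> carrier_vec n" and eq: "A *\<^sub>v y + vec n (\<lambda>_. 1) = \<mu> \<cdot>\<^sub>v y"
    by (rule solution_if_not_eigenvalue[OF A(1) _ assms(4)]) auto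
  have Ay: "(A *\<^sub>v y) $ i = \<mu> * y $ i - 1" if "i < n" for i
    using arg_cong[OF eq, of "\<lambda>v. v $ i"] that A(1) y by (simp add: eq_diff_eq)
  define \<delta> where "\<delta> = 1 / (1 + (\<Sum>i<n. \<bar>y $ i\<bar>))"
  have pos: "0 < 1 + (\<Sum>i<n. \<bar>y $ i\<bar>)" by (intro add_pos_nonneg sum_nonneg) auto
  then have "0 < \<delta>" by (simp add: \<delta>_def)
  have small: "\<bar>\<delta> * y $ i\<bar> < 1" if "i < n" for i
  proof -
    have "\<bar>y $ i\<bar> \<le> (\<Sum>i<n. \<bar>y $ i\<bar>)" using that by (intro member_le_sum) auto
    then show ?thesis using pos by (simp add: \<delta>_def)
  qed
  have "\<mu> * y $ i - 1 \<le> (\<mu> + \<delta>) * y $ i" if "i < n" for i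
    using small[OF that] by (simp add: abs_less_iff distrib_right)
  then have "A *\<^sub>v y \<le> (\<mu> + \<delta>) \<cdot>\<^sub>v y"
    using Ay A(1) y by (simp add: less_eq_vec_def)
  moreover obtain x where "strict_supersolution A (\<mu> + \<delta>) x"
    using assms(3)[of "\<mu> + \<delta>"] \<open>0 < \<delta>\<close> by auto
  ultimately have nonneg: "0\<^sub>v n \<le> y" using metzler_supersolution_nonneg[OF A] by blast
  have "0 < y $ i" if "i < n" for i
    using metzler_diag_le[OF A nonneg that] Ay[OF that] nonneg_vecD(2)[OF nonneg that]
    by (cases "y $ i = 0") auto
  moreover have "\<mu> * y $ i - 1 < (\<mu> - \<delta>) * y $ i" if "i < n" for i
    using small[OF that] by (simp add: abs_less_iff left_diff_distrib)
  ultimately have "strict_supersolution A (\<mu> - \<delta>) y"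
    using Ay A(1) y by (simp add: strict_supersolution_def)
  then show ?thesis using \<open>0 < \<delta>\<close> by (intro exI[of _ "\<mu> - \<delta>"]) auto
qed

theorem metzler_eigenvalue:
  fixes A :: "real mat"
  assumes "0 < n" and A: "A \<in> carrier_mat n n" "metzler_mat A"
  obtains \<mu> where "eigenvalue A \<mu>" "\<And>c. \<mu> < c \<Longrightarrow> \<exists>x. strict_supersolution A c x"
proof -
  define S where "S = {c. \<exists>x. strict_supersolution A c x}"
  have "S \<noteq> {}" using ex_strict_supersolution[OF A(1)] by (simp add: S_def)
  have "A $$ (0, 0) \<le> c" if "c \<in> S" for c
  proof -
    obtain x where "strict_supersolution A c x" using \<open>c \<in> S\<close> by (auto simp: S_def)
    note x = strict_supersolutionD[OF A(1) this]
    have "A $$ (0, 0) * x $ 0 < c * x $ 0"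
      using metzler_diag_le[OF A x(4) \<open>0 < n\<close>] x(3)[OF \<open>0 < n\<close>] by (rule le_less_trans)
    then show ?thesis using x(2)[OF \<open>0 < n\<close>] by simp
  qed
  then have bdd: "bdd_below S" by (rule bdd_belowI)
  have above: "c \<in> S" if "Inf S < c" for c
    using cInf_lessD[OF \<open>S \<noteq> {}\<close> that] strict_supersolution_mono less_imp_le
    unfolding S_def by blast
  have "eigenvalue A (Inf S)"
  proof (rule ccontr)
    assume "\<not> eigenvalue A (Inf S)"
    then obtain c where "c < Inf S" "c \<in> S"
      using metzler_ex_smaller_strict_supersolution[OF A, of "Inf S"] above unfolding S_def by blast
    then show False using cInf_lower[OF _ bdd] by fastforce
  qed
  then show ?thesis using above by (intro that) (auto simp: S_def)
qed

section \<open>Nonnegative matrices\<close>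

lemma nonneg_mat_imp_metzler: "0\<^sub>m n n \<le> A \<Longrightarrow> metzler_mat A"
  by (auto simp: metzler_mat_def less_eq_mat_def)

lemma eigenvector_norm_le:
  fixes A :: "'a::real_normed_field mat"
  assumes A: "A \<in> carrier_mat n n" and "eigenvector A v k"
  shows "norm k \<cdot>\<^sub>v map_vec norm v \<le> map_mat norm A *\<^sub>v map_vec norm v"
proof -
  have v: "v \<in> carrier_vec n" and eig: "A *\<^sub>v v = k \<cdot>\<^sub>v v"
    using assms by (auto simp: eigenvector_def)
  have norm_A: "map_mat norm A \<in> carrier_mat n n" and norm_v: "map_vec norm v \<in> carrier_vec n"
    using A v by auto
  have "norm k * norm (v $ i) \<le> (map_mat norm A *\<^sub>v map_vec norm v) $ i" if "i < n" for i
  proof -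
    have "norm k * norm (v $ i) = norm ((A *\<^sub>v v) $ i)"
      unfolding eig using that v by (simp add: norm_mult)
    also have "\<dots> = norm (\<Sum>j<n. A $$ (i, j) * v $ j)"
      by (simp only: index_mult_mat_vec_sum[OF A v that])
    also have "\<dots> \<le> (\<Sum>j<n. norm (A $$ (i, j) * v $ j))" by (rule norm_sum)
    also have "\<dots> = (\<Sum>j<n. map_mat norm A $$ (i, j) * map_vec norm v $ j)"
      using A v that by (intro sum.cong) (auto simp: norm_mult)
    also have "\<dots> = (map_mat norm A *\<^sub>v map_vec norm v) $ i"
      by (simp only: index_mult_mat_vec_sum[OF norm_A norm_v that])
    finally show ?thesis .
  qed
  then show ?thesis using A v by (simp add: less_eq_vec_def)
qed

lemma real_eigenvalue_le_spectral_radius: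
  assumes "0 < n" and C: "C \<in> carrier_mat n n" and "eigenvalue C r"
  shows "r \<le> real_spectral_radius C"
proof -
  have "eigenvalue (map_mat complex_of_real C) (complex_of_real r)"
    using of_real_hom.eigenvalue_hom[OF C assms(3)] .
  then have "norm (complex_of_real r) \<in> norm ` spectrum (map_mat complex_of_real C)"
    by (intro imageI) (simp add: spectrum_def)
  then have "norm (complex_of_real r) \<le> real_spectral_radius C"
    unfolding real_spectral_radius_def using C \<open>0 < n\<close>
    by (intro spectral_radius_mem_max(2)[of _ n]) auto
  then show ?thesis by simp
qed

lemma spectral_radius_subsolution:
  assumes "0 < n" and C: "0\<^sub>m n n \<le> C"
  obtains z where "0\<^sub>v n \<le> z" "z \<noteq> 0\<^sub>v n" "real_spectral_radius C \<cdot>\<^sub>v z \<le> C *\<^sub>v z"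
proof -
  let ?C = "map_mat complex_of_real C"
  have carrier: "?C \<in> carrier_mat n n" using nonneg_matD(1)[OF C] by simp
  obtain k v where k: "norm k = real_spectral_radius C" and v: "eigenvector ?C v k"
    using spectral_radius_mem_max(1)[OF carrier \<open>0 < n\<close>]
    by (auto simp: real_spectral_radius_def spectrum_def eigenvalue_def)
  have "map_mat norm ?C = C"
    using C by (intro eq_matI) (auto simp: less_eq_mat_def)
  then have "real_spectral_radius C \<cdot>\<^sub>v map_vec norm v \<le> C *\<^sub>v map_vec norm v"
    using eigenvector_norm_le[OF carrier v] k by simp
  moreover have "v \<in> carrier_vec n" "v \<noteq> 0\<^sub>v n"
    using v carrier by (auto simp: eigenvector_def)
  then have "0\<^sub>v n \<le> map_vec norm v" "map_vec norm v \<noteq> 0\<^sub>v n"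
    by (auto simp: less_eq_vec_def vec_eq_iff)
  ultimately show ?thesis using that by blast
qed

lemma spectral_radius_less_if_strict_supersolution:
  assumes "0 < n" and C: "0\<^sub>m n n \<le> C" and "strict_supersolution C c x"
  shows "real_spectral_radius C < c"
proof (rule ccontr)
  assume "\<not> real_spectral_radius C < c"
  then have x: "strict_supersolution C (real_spectral_radius C) x"
    by (intro strict_supersolution_mono[OF assms(3)]) simp
  note carrier = nonneg_matD(1)[OF C]
  obtain z where z: "0\<^sub>v n \<le> z" "z \<noteq> 0\<^sub>v n" "real_spectral_radius C \<cdot>\<^sub>v z \<le> C *\<^sub>v z"
    using spectral_radius_subsolution[OF \<open>0 < n\<close> C] .
  have "C *\<^sub>v (- z) \<le> real_spectral_radius C \<cdot>\<^sub>v (- z)"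
    using z(3) nonneg_vecD(1)[OF z(1)] carrier
    by (auto simp: less_eq_vec_def index_mult_mat_vec)
  then have "0\<^sub>v n \<le> - z"
    using metzler_supersolution_nonneg[OF carrier nonneg_mat_imp_metzler[OF C] x] by blast
  then have "z \<le> 0\<^sub>v n" by (auto simp: less_eq_vec_def)
  then show False using z(1,2) by simp
qed

lemma obtain_permutes_onto_final_segment:
  assumes "Z \<subseteq> {..<n}"
  obtains p where "p permutes {..<n}" "\<forall>i<n. p i \<in> Z \<longleftrightarrow> n - card Z \<le> i"
proof -
  let ?k = "n - card Z"
  have "finite Z" using assms finite_subset by blast
  have card_compl: "card ({..<n} - Z) = ?k"
    using card_Diff_subset[OF \<open>finite Z\<close> assms] by simp
  have "card Z \<le> n" using card_mono[OF _ assms] by simp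
  have card_eq: "card {i. i < n \<and> b = (i < ?k)} = card {i. i < n \<and> b = (i \<notin> Z)}" for b
  proof (cases b)
    case True
    then have "{i. i < n \<and> b = (i < ?k)} = {..<?k}" "{i. i < n \<and> b = (i \<notin> Z)} = {..<n} - Z"
      by auto
    then show ?thesis by (simp add: card_compl)
  next
    case False
    then have "{i. i < n \<and> b = (i < ?k)} = {?k..<n}" "{i. i < n \<and> b = (i \<notin> Z)} = Z"
      using assms by auto
    then show ?thesis using \<open>card Z \<le> n\<close> by simp
  qed
  have "image_mset (\<lambda>i. i < ?k) (mset_set {..<n}) = image_mset (\<lambda>i. i \<notin> Z) (mset_set {..<n})"
    by (rule multiset_eqI) (simp add: count_image_mset' card_eq)
  then obtain p where p: "p permutes {..<n}" "\<forall>i\<in>{..<n}. (i < ?k) = (p i \<notin> Z)"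
    using image_mset_eq_implies_permutes[OF finite_lessThan] by blast
  have "\<forall>i<n. p i \<in> Z \<longleftrightarrow> ?k \<le> i" using p(2) by (metis lessThan_iff not_less)
  with p(1) show ?thesis by (rule that)
qed

lemma reducible_if_zero_block:
  assumes C: "C \<in> carrier_mat n n" and Z: "Z \<subseteq> {..<n}" "Z \<noteq> {}" "Z \<noteq> {..<n}"
    and zero: "\<And>i j. i \<in> Z \<Longrightarrow> j \<in> {..<n} - Z \<Longrightarrow> C $$ (i, j) = 0"
  shows "reducible_mat C"
proof -
  let ?k = "n - card Z"
  obtain p where p: "p permutes {..<n}" "\<forall>i<n. p i \<in> Z \<longleftrightarrow> ?k \<le> i"
    using obtain_permutes_onto_final_segment[OF Z(1)] .
  have "0 < card Z" using Z(1,2) finite_subset[OF Z(1)] by (simp add: card_gt_0_iff)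
  moreover have "card Z < n" using psubset_card_mono[of "{..<n}" Z] Z(1,3) by auto
  ultimately have "0 < ?k" "?k < n" by simp_all
  moreover have "C $$ (p i, p j) = 0" if "i \<in> {?k..<n}" "j < ?k" for i j
  proof (rule zero)
    show "p i \<in> Z" using p(2) that(1) by simp
    show "p j \<in> {..<n} - Z"
      using p(2) that(2) permutes_in_image[OF p(1), of j] by auto
  qed
  ultimately show ?thesis
    unfolding reducible_mat_def using p(1) C by (intro exI[of _ p] exI[of _ ?k]) auto
qed

lemma irreducible_supersolution_pos:
  assumes C: "0\<^sub>m n n \<le> C" "irreducible_mat C"
    and x: "0\<^sub>v n \<le> x" "x \<noteq> 0\<^sub>v n" "C *\<^sub>v x \<le> r \<cdot>\<^sub>v x" and "k < n"
  shows "0 < x $ k"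
proof (rule ccontr)
  assume "\<not> 0 < x $ k"
  define Z where "Z = {i. i < n \<and> x $ i = 0}"
  note carrier = nonneg_matD(1)[OF C(1)] nonneg_vecD(1)[OF x(1)]
  have "reducible_mat C"
  proof (rule reducible_if_zero_block[OF carrier(1)])
    show "Z \<subseteq> {..<n}" by (auto simp: Z_def)
    show "Z \<noteq> {}" using \<open>\<not> 0 < x $ k\<close> \<open>k < n\<close> nonneg_vecD(2)[OF x(1)] by (force simp: Z_def)
    show "Z \<noteq> {..<n}" using x(2) carrier(2) by (auto simp: Z_def vec_eq_iff)
    fix i j assume i: "i \<in> Z" and j: "j \<in> {..<n} - Z"
    have "i < n" "x $ i = 0" using i by (auto simp: Z_def)
    have nonneg: "0 \<le> C $$ (i, j') * x $ j'" if "j' < n" for j'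
      using nonneg_matD(2)[OF C(1) \<open>i < n\<close> that] nonneg_vecD(2)[OF x(1) that] by simp
    have "(C *\<^sub>v x) $ i \<le> r * x $ i"
      using x(3) \<open>i < n\<close> carrier(2) by (auto simp: less_eq_vec_def)
    then have "(\<Sum>j<n. C $$ (i, j) * x $ j) \<le> 0"
      unfolding index_mult_mat_vec_sum[OF carrier \<open>i < n\<close>] using \<open>x $ i = 0\<close> by simp
    then have "(\<Sum>j<n. C $$ (i, j) * x $ j) = 0"
      using nonneg by (intro antisym sum_nonneg) auto
    then have "C $$ (i, j) * x $ j = 0"
      using nonneg j by (subst (asm) sum_nonneg_eq_0_iff) auto
    then show "C $$ (i, j) = 0" using j by (auto simp: Z_def)
  qed
  then show False using C(2) by (simp add: irreducible_mat_def)
qed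

lemma irreducible_subsolution_proportional:
  assumes C: "0\<^sub>m n n \<le> C" "irreducible_mat C"
    and w: "0\<^sub>v n \<le> w" "w \<noteq> 0\<^sub>v n" "C *\<^sub>v w \<le> r \<cdot>\<^sub>v w"
    and z: "0\<^sub>v n \<le> z" "z \<noteq> 0\<^sub>v n" "r \<cdot>\<^sub>v z \<le> C *\<^sub>v z"
  obtains t where "0 < t" "z = t \<cdot>\<^sub>v w"
proof -
  note carrier = nonneg_matD(1)[OF C(1)] nonneg_vecD(1)[OF w(1)] nonneg_vecD(1)[OF z(1)]
  note w_pos = irreducible_supersolution_pos[OF C w]
  obtain k where "k < n" "z $ k \<noteq> 0" using z(2) carrier(3) by (auto simp: vec_eq_iff)
  then have "0 < z $ k" using nonneg_vecD(2)[OF z(1), of k] by simp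
  obtain t i where touch: "i < n" "z $ i = t * w $ i"
    and below: "\<And>j. j < n \<Longrightarrow> z $ j \<le> t * w $ j"
    using obtain_max_ratio[of "{..<n}" "\<lambda>i. w $ i" "\<lambda>i. z $ i"] w_pos \<open>k < n\<close>
    by (metis emptyE finite_lessThan lessThan_iff)
  have "0 < t * w $ k" using \<open>0 < z $ k\<close> below[OF \<open>k < n\<close>] by simp
  then have "0 < t" using w_pos[OF \<open>k < n\<close>] by (simp add: zero_less_mult_iff)
  define x where "x = t \<cdot>\<^sub>v w - z"
  have "(C *\<^sub>v x) $ j \<le> r * x $ j" if "j < n" for j
  proof -
    have "(C *\<^sub>v x) $ j = t * (C *\<^sub>v w) $ j - (C *\<^sub>v z) $ j"
      using carrier that
      by (simp add: x_def mult_minus_distrib_mat_vec[OF carrier(1)] mult_mat_vec[OF carrier(1)])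
    also have "\<dots> \<le> t * (r * w $ j) - r * z $ j"
      using w(3) z(3) that carrier \<open>0 < t\<close>
      by (intro diff_mono mult_left_mono) (auto simp: less_eq_vec_def)
    also have "\<dots> = r * x $ j" using that carrier by (simp add: x_def algebra_simps)
    finally show ?thesis .
  qed
  then have "C *\<^sub>v x \<le> r \<cdot>\<^sub>v x"
    using carrier by (simp add: less_eq_vec_def x_def)
  moreover have "0\<^sub>v n \<le> x" using below carrier by (simp add: less_eq_vec_def x_def)
  moreover have "x $ i = 0" using touch carrier by (simp add: x_def)
  ultimately have "x = 0\<^sub>v n"
    using irreducible_supersolution_pos[OF C, of x r i] touch(1) by force
  then have "x $ j = 0" if "j < n" for j using that by simp
  then have "z = t \<cdot>\<^sub>v w" using carrier by (intro eq_vecI) (simp_all add: x_def)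
  with \<open>0 < t\<close> show ?thesis by (rule that)
qed

lemma irreducible_supersolution_eigenvector:
  assumes "0 < n" and C: "0\<^sub>m n n \<le> C" "irreducible_mat C"
    and w: "0\<^sub>v n \<le> w" "w \<noteq> 0\<^sub>v n" "C *\<^sub>v w \<le> real_spectral_radius C \<cdot>\<^sub>v w"
  shows "C *\<^sub>v w = real_spectral_radius C \<cdot>\<^sub>v w"
proof (rule antisym[OF w(3)])
  note carrier = nonneg_matD(1)[OF C(1)] nonneg_vecD(1)[OF w(1)]
  obtain z where z: "0\<^sub>v n \<le> z" "z \<noteq> 0\<^sub>v n" "real_spectral_radius C \<cdot>\<^sub>v z \<le> C *\<^sub>v z"
    using spectral_radius_subsolution[OF \<open>0 < n\<close> C(1)] .
  obtain t where "0 < t" "z = t \<cdot>\<^sub>v w"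
    using irreducible_subsolution_proportional[OF C w z] .
  then have "real_spectral_radius C \<cdot>\<^sub>v (t \<cdot>\<^sub>v w) \<le> t \<cdot>\<^sub>v (C *\<^sub>v w)"
    using z(3) by (simp add: mult_mat_vec[OF carrier])
  then show "real_spectral_radius C \<cdot>\<^sub>v w \<le> C *\<^sub>v w"
    using \<open>0 < t\<close> carrier by (simp add: less_eq_vec_def mult.left_commute)
qed

lemma irreducible_spectral_radius_le:
  assumes "0 < n" and C: "0\<^sub>m n n \<le> C" "irreducible_mat C"
    and w: "0\<^sub>v n \<le> w" "w \<noteq> 0\<^sub>v n" "C *\<^sub>v w \<le> r \<cdot>\<^sub>v w"
  shows "real_spectral_radius C \<le> r"
proof (rule dense_ge)
  fix c assume "r < c"
  have "strict_supersolution C c w"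
    unfolding strict_supersolution_def
  proof (intro conjI allI impI)
    show "w \<in> carrier_vec (dim_row C)"
      using nonneg_matD(1)[OF C(1)] nonneg_vecD(1)[OF w(1)] by simp
    fix i assume "i < dim_row C"
    then have "i < n" using nonneg_matD(1)[OF C(1)] by simp
    then show "0 < w $ i" by (rule irreducible_supersolution_pos[OF C w])
    then have "r * w $ i < c * w $ i" using \<open>r < c\<close> by simp
    moreover have "(C *\<^sub>v w) $ i \<le> r * w $ i"
      using w(3) \<open>i < n\<close> nonneg_vecD(1)[OF w(1)] by (auto simp: less_eq_vec_def)
    ultimately show "(C *\<^sub>v w) $ i < c * w $ i" by simp
  qed
  then show "real_spectral_radius C \<le> c"
    using spectral_radius_less_if_strict_supersolution[OF \<open>0 < n\<close> C(1)] by (simp add: less_imp_le)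
qed

lemma irreducible_spectral_radius_eq_iff:
  assumes "0 < n" and C: "0\<^sub>m n n \<le> C" "irreducible_mat C"
    and w: "0\<^sub>v n \<le> w" "w \<noteq> 0\<^sub>v n" "C *\<^sub>v w \<le> r \<cdot>\<^sub>v w"
  shows "real_spectral_radius C = r \<longleftrightarrow> C *\<^sub>v w = r \<cdot>\<^sub>v w"
proof
  assume "real_spectral_radius C = r"
  then show "C *\<^sub>v w = r \<cdot>\<^sub>v w"
    using irreducible_supersolution_eigenvector[OF \<open>0 < n\<close> C] w by blast
next
  note carrier = nonneg_matD(1)[OF C(1)]
  assume "C *\<^sub>v w = r \<cdot>\<^sub>v w"
  then have "eigenvalue C r"
    using carrier nonneg_vecD(1)[OF w(1)] w(2) by (auto simp: eigenvalue_def eigenvector_def)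
  then have "r \<le> real_spectral_radius C"
    by (rule real_eigenvalue_le_spectral_radius[OF \<open>0 < n\<close> carrier])
  then show "real_spectral_radius C = r"
    using irreducible_spectral_radius_le[OF assms] by simp
qed

section \<open>Rooted matrices\<close>

definition rooted_basis :: "nat \<Rightarrow> real mat" where
  "rooted_basis l = mat l l (\<lambda>(i, j). if i = j \<or> j = l - 1 then 1 else 0)"

definition rooted_basis_inv :: "nat \<Rightarrow> real mat" where
  "rooted_basis_inv l = mat l l (\<lambda>(i, j). if i = j then 1 else if j = l - 1 then - 1 else 0)"

lemma rooted_basis_carrier [simp]:
  "rooted_basis l \<in> carrier_mat l l" "rooted_basis_inv l \<in> carrier_mat l l"
  by (simp_all add: rooted_basis_def rooted_basis_inv_def)

lemma rooted_basis_dim [simp]: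
  "dim_row (rooted_basis l) = l" "dim_col (rooted_basis l) = l"
  "dim_row (rooted_basis_inv l) = l" "dim_col (rooted_basis_inv l) = l"
  by (simp_all add: rooted_basis_def rooted_basis_inv_def)

lemma index_rooted_basis_mult_vec:
  assumes "x \<in> carrier_vec l" "i < l"
  shows "(rooted_basis l *\<^sub>v x) $ i = (if i = l - 1 then x $ i else x $ i + x $ (l - 1))"
proof -
  have "(rooted_basis l *\<^sub>v x) $ i = (\<Sum>j<l. rooted_basis l $$ (i, j) * x $ j)"
    by (rule index_mult_mat_vec_sum[OF rooted_basis_carrier(1) assms])
  also have "\<dots> = (\<Sum>j<l. (if j = i then x $ j else 0) +
      (if j = l - 1 \<and> i \<noteq> l - 1 then x $ j else 0))"
    using assms(2) by (intro sum.cong) (auto simp: rooted_basis_def)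
  also have "\<dots> = (if i = l - 1 then x $ i else x $ i + x $ (l - 1))"
    using assms(2) by (simp add: sum.distrib)
  finally show ?thesis .
qed

lemma index_mult_rooted_basis:
  assumes "A \<in> carrier_mat m l" "i < m" "j < l"
  shows "(A * rooted_basis l) $$ (i, j) = (if j = l - 1 then row_sum_vec A $ i else A $$ (i, j))"
proof -
  have "(A * rooted_basis l) $$ (i, j) = (\<Sum>c<l. A $$ (i, c) * rooted_basis l $$ (c, j))"
    using assms by (auto simp: scalar_prod_def lessThan_atLeast0 rooted_basis_def)
  also have "\<dots> = (\<Sum>c<l. if j = l - 1 \<or> c = j then A $$ (i, c) else 0)"
    using assms(3) by (intro sum.cong) (auto simp: rooted_basis_def)
  also have "\<dots> = (if j = l - 1 then row_sum_vec A $ i else A $$ (i, j))"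
    using assms by (simp add: row_sum_vec_def)
  finally show ?thesis .
qed

lemma index_rooted_basis_inv_mult:
  assumes "A \<in> carrier_mat l m" "i < l" "j < m"
  shows "(rooted_basis_inv l * A) $$ (i, j) =
    (if i = l - 1 then A $$ (i, j) else A $$ (i, j) - A $$ (l - 1, j))"
proof -
  have "(rooted_basis_inv l * A) $$ (i, j) = (\<Sum>c<l. rooted_basis_inv l $$ (i, c) * A $$ (c, j))"
    using assms by (auto simp: scalar_prod_def lessThan_atLeast0 rooted_basis_inv_def)
  also have "\<dots> = (\<Sum>c<l. (if c = i then A $$ (c, j) else 0) -
      (if c = l - 1 \<and> i \<noteq> l - 1 then A $$ (c, j) else 0))"
    using assms(2) by (intro sum.cong) (auto simp: rooted_basis_inv_def)
  also have "\<dots> = (if i = l - 1 then A $$ (i, j) else A $$ (i, j) - A $$ (l - 1, j))"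
    using assms(2) by (simp add: sum_subtractf)
  finally show ?thesis .
qed

lemma rooted_basis_inverse:
  "rooted_basis_inv l * rooted_basis l = 1\<^sub>m l" "rooted_basis l * rooted_basis_inv l = 1\<^sub>m l"
proof -
  show inv: "rooted_basis_inv l * rooted_basis l = 1\<^sub>m l"
  proof (rule eq_matI)
    fix i j assume "i < dim_row (1\<^sub>m l :: real mat)" "j < dim_col (1\<^sub>m l :: real mat)"
    then show "(rooted_basis_inv l * rooted_basis l) $$ (i, j) = 1\<^sub>m l $$ (i, j)"
      by (subst index_rooted_basis_inv_mult[of _ l l]) (auto simp: rooted_basis_def)
  qed (auto simp: rooted_basis_def rooted_basis_inv_def)
  show "rooted_basis l * rooted_basis_inv l = 1\<^sub>m l"
    by (rule mat_mult_left_right_inverse[OF _ _ inv]) auto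
qed

lemma rooted_vec_nonneg:
  assumes "rooted_vec v" "i < dim_vec v"
  shows "0 \<le> v $ i"
proof (cases "i = dim_vec v - 1")
  case False
  then have "v $ (dim_vec v - 1) \<le> v $ i" "0 \<le> v $ (dim_vec v - 1)"
    using assms by (simp_all add: rooted_vec_def)
  then show ?thesis by simp
qed (use assms in \<open>simp add: rooted_vec_def\<close>)

lemma rooted_vec_rooted_basis_mult:
  assumes "0 < l" "0\<^sub>v l \<le> x"
  shows "rooted_vec (rooted_basis l *\<^sub>v x)"
  using assms nonneg_vecD[OF assms(2)]
  by (simp add: rooted_vec_def index_rooted_basis_mult_vec)

lemma row_sum_vec_add_smult_one:
  assumes "M \<in> carrier_mat l l" "i < l"
  shows "row_sum_vec (M + d \<cdot>\<^sub>m 1\<^sub>m l) $ i = row_sum_vec M $ i + d"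
  using assms by (simp add: row_sum_vec_def sum.distrib flip: sum_distrib_left)

definition rooted_conjugate :: "nat \<Rightarrow> real mat \<Rightarrow> real mat" where
  "rooted_conjugate l M = rooted_basis_inv l * M * rooted_basis l"

lemma rooted_conjugate_carrier:
  "M \<in> carrier_mat l l \<Longrightarrow> rooted_conjugate l M \<in> carrier_mat l l"
  unfolding rooted_conjugate_def by (intro mult_carrier_mat[of _ l l]) simp_all

lemma similar_mat_rooted_conjugate:
  assumes "M \<in> carrier_mat l l"
  shows "similar_mat (rooted_conjugate l M) M"
  using assms rooted_conjugate_carrier[OF assms] rooted_basis_inverse
  by (intro similar_matI[of _ _ _ _ l]) (simp_all add: rooted_conjugate_def)

lemma rooted_basis_mult_conjugate:
  assumes "M \<in> carrier_mat l l"
  shows "rooted_basis l * rooted_conjugate l M = M * rooted_basis l"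
proof -
  have "rooted_basis l * rooted_conjugate l M =
      rooted_basis l * rooted_basis_inv l * (M * rooted_basis l)"
    using assms by (simp add: rooted_conjugate_def assoc_mult_mat[of _ l l _ l _ l])
  then show ?thesis
    using assms by (simp add: rooted_basis_inverse left_mult_one_mat[of _ l l])
qed

lemma metzler_rooted_conjugate:
  assumes M: "M \<in> carrier_mat l l" "rooted_mat M"
  shows "metzler_mat (rooted_conjugate l M)"
proof -
  have conjugate_eq: "rooted_conjugate l M = rooted_basis_inv l * (M * rooted_basis l)"
    unfolding rooted_conjugate_def
    by (rule assoc_mult_mat[OF rooted_basis_carrier(2) M(1) rooted_basis_carrier(1)])
  have MB_carrier: "M * rooted_basis l \<in> carrier_mat l l" using M(1) by simp
  obtain d where d: "\<And>j. j < l - 1 \<Longrightarrow> rooted_vec (col (M + d \<cdot>\<^sub>m 1\<^sub>m l) j)"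
      "rooted_vec (row_sum_vec (M + d \<cdot>\<^sub>m 1\<^sub>m l))"
    using M by (auto simp: rooted_mat_def Let_def)
  have col_nonneg: "0 \<le> M $$ (l - 1, j)" if "j < l - 1" for j
    using d(1)[OF that] that M(1) by (auto simp: rooted_vec_def)
  have col_ge: "M $$ (l - 1, j) \<le> M $$ (i, j)" if "i < l - 1" "j < l - 1" "i \<noteq> j" for i j
    using d(1)[OF that(2)] that M(1) by (auto simp: rooted_vec_def)
  have row_ge: "row_sum_vec M $ (l - 1) \<le> row_sum_vec M $ i" if "i < l - 1" for i
  proof -
    have "dim_vec (row_sum_vec (M + d \<cdot>\<^sub>m 1\<^sub>m l)) = l" by (simp add: row_sum_vec_def)
    then show ?thesis
      using d(2) that by (simp add: rooted_vec_def row_sum_vec_add_smult_one[OF M(1)])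
  qed
  have "0 \<le> rooted_conjugate l M $$ (i, j)" if "i < l" "j < l" "i \<noteq> j" for i j
    unfolding conjugate_eq index_rooted_basis_inv_mult[OF MB_carrier that(1,2)]
    using col_ge[of i j] col_nonneg[of j] row_ge[of i] that
    by (simp add: index_mult_rooted_basis[OF M(1)])
  then show ?thesis
    using rooted_conjugate_carrier[OF M(1)] by (auto simp: metzler_mat_def)
qed

lemma similar_mat_imp_eigenvalue_iff:
  assumes "A \<in> carrier_mat n n" "similar_mat A (B :: 'a::field mat)"
  shows "eigenvalue A k \<longleftrightarrow> eigenvalue B k"
proof -
  have "B \<in> carrier_mat n n" using similar_matD[OF assms(2)] assms(1) by auto
  then show ?thesis
    using eigenvalue_root_char_poly assms(1) char_poly_similar[OF assms(2)] by metis
qed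

lemma strict_supersolution_rooted_basis_mult:
  assumes M: "M \<in> carrier_mat l l" and "strict_supersolution (rooted_conjugate l M) c x"
  shows "strict_supersolution M c (rooted_basis l *\<^sub>v x)"
proof -
  let ?K = "rooted_conjugate l M" and ?v = "rooted_basis l *\<^sub>v x"
  note K = rooted_conjugate_carrier[OF M]
  note x = strict_supersolutionD[OF K assms(2)]
  have M_mult: "M *\<^sub>v ?v = rooted_basis l *\<^sub>v (?K *\<^sub>v x)"
    using rooted_basis_mult_conjugate[OF M] M K x(1)
    by (metis assoc_mult_mat_vec rooted_basis_carrier(1))
  have Kx_carrier: "?K *\<^sub>v x \<in> carrier_vec l" using K x(1) by simp
  have "0 < ?v $ i \<and> (M *\<^sub>v ?v) $ i < c * ?v $ i" if "i < l" for i
    using x(2,3)[OF that] x(2,3)[of "l - 1"] that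
    unfolding M_mult index_rooted_basis_mult_vec[OF Kx_carrier that]
      index_rooted_basis_mult_vec[OF x(1) that]
    by (auto simp: distrib_left intro: add_pos_pos add_strict_mono)
  then show ?thesis
    using M mult_mat_vec_carrier[OF rooted_basis_carrier(1) x(1)]
    by (simp add: strict_supersolution_def)
qed

theorem rooted_mat_eigenvalue:
  assumes "0 < l" and M: "M \<in> carrier_mat l l" "rooted_mat M"
  obtains \<mu> where "eigenvalue M \<mu>"
    and "\<And>c. \<mu> < c \<Longrightarrow> \<exists>v. rooted_vec v \<and> strict_supersolution M c v"
proof -
  let ?K = "rooted_conjugate l M"
  note K = rooted_conjugate_carrier[OF M(1)]
  obtain \<mu> where \<mu>: "eigenvalue ?K \<mu>"
    and above: "\<And>c. \<mu> < c \<Longrightarrow> \<exists>x. strict_supersolution ?K c x"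
    using metzler_eigenvalue[OF \<open>0 < l\<close> K metzler_rooted_conjugate[OF M]] by blast
  show ?thesis
  proof (rule that)
    show "eigenvalue M \<mu>"
      using similar_mat_imp_eigenvalue_iff[OF K similar_mat_rooted_conjugate[OF M(1)]] \<mu> by blast
    fix c assume "\<mu> < c"
    then obtain x where x: "strict_supersolution ?K c x" using above by blast
    have "rooted_vec (rooted_basis l *\<^sub>v x)"
      using rooted_vec_rooted_basis_mult[OF \<open>0 < l\<close>] strict_supersolutionD(4)[OF K x] .
    then show "\<exists>v. rooted_vec v \<and> strict_supersolution M c v"
      using strict_supersolution_rooted_basis_mult[OF M(1) x] by blast
  qed
qed

section \<open>Blockwise constant vectors\<close>

definition block_index :: "nat \<Rightarrow> (nat \<Rightarrow> nat set) \<Rightarrow> nat \<Rightarrow> nat" where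
  "block_index l \<pi> i = (THE a. a < l \<and> i \<in> \<pi> a)"

definition block_lift :: "nat \<Rightarrow> nat \<Rightarrow> (nat \<Rightarrow> nat set) \<Rightarrow> 'a vec \<Rightarrow> 'a vec" where
  "block_lift n l \<pi> v = vec n (\<lambda>i. v $ block_index l \<pi> i)"

lemma block_lift_carrier [simp]:
  "block_lift n l \<pi> v \<in> carrier_vec n" "dim_vec (block_lift n l \<pi> v) = n"
  by (simp_all add: block_lift_def)

lemma indexed_partitionD:
  assumes "indexed_partition n l \<pi>" "a < l"
  shows "\<pi> a \<noteq> {}" and "\<pi> a \<subseteq> {..<n}" and "finite (\<pi> a)"
proof -
  show "\<pi> a \<noteq> {}" "\<pi> a \<subseteq> {..<n}" using assms by (auto simp: indexed_partition_def)
  then show "finite (\<pi> a)" using finite_subset by blast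
qed

lemma indexed_partition_all_iff:
  assumes "indexed_partition n l \<pi>"
  shows "(\<forall>i<n. P i) \<longleftrightarrow> (\<forall>a<l. \<forall>i\<in>\<pi> a. P i)"
  using assms unfolding indexed_partition_def by blast

lemma block_index_eq:
  assumes "indexed_partition n l \<pi>" "a < l" "i \<in> \<pi> a"
  shows "block_index l \<pi> i = a"
  unfolding block_index_def using assms
  by (intro the_equality) (auto simp: indexed_partition_def disjoint_family_on_def)

lemma index_block_lift:
  assumes "indexed_partition n l \<pi>" "a < l" "i \<in> \<pi> a"
  shows "block_lift n l \<pi> v $ i = v $ a"
  using indexed_partitionD(2)[OF assms(1,2)] block_index_eq[OF assms] assms(3)
  by (auto simp: block_lift_def)

lemma block_lift_all_iff:
  assumes "indexed_partition n l \<pi>"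
  shows "(\<forall>i<n. P (block_lift n l \<pi> v $ i)) \<longleftrightarrow> (\<forall>a<l. P (v $ a))"
  unfolding indexed_partition_all_iff[OF assms]
  using index_block_lift[OF assms, of _ _ v] indexed_partitionD(1)[OF assms] by auto

lemma sum_over_blocks:
  fixes f :: "nat \<Rightarrow> 'a::comm_monoid_add"
  assumes "indexed_partition n l \<pi>"
  shows "(\<Sum>j<n. f j) = (\<Sum>b<l. \<Sum>j\<in>\<pi> b. f j)"
proof -
  have "{..<n} = (\<Union>b<l. \<pi> b)" using assms by (simp add: indexed_partition_def)
  then show ?thesis
    using assms indexed_partitionD(3)[OF assms]
    by (auto simp: indexed_partition_def disjoint_family_on_def intro!: sum.UNION_disjoint)
qed

lemma summation_by_parts_last:
  fixes p x :: "nat \<Rightarrow> 'a::comm_ring"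
  assumes "0 < l"
  shows "(\<Sum>b<l. p b * x b) = (\<Sum>b<l - 1. p b * (x b - x (l - 1))) + (\<Sum>b<l. p b) * x (l - 1)"
proof -
  obtain m where "l = Suc m" using assms gr0_implies_Suc by blast
  then show ?thesis
    by (simp add: algebra_simps sum_subtractf sum_distrib_left sum_distrib_right)
qed

lemma block_lift_row_defect:
  fixes M C :: "'a::comm_ring mat"
  assumes "0 < l" and part: "indexed_partition n l \<pi>"
    and M: "M \<in> carrier_mat k l" and C: "C \<in> carrier_mat m n" and v: "v \<in> carrier_vec l"
    and "a < k" "i < m"
  shows "(M *\<^sub>v v) $ a - (C *\<^sub>v block_lift n l \<pi> v) $ i =
    (\<Sum>b<l - 1. (M $$ (a, b) - (\<Sum>j\<in>\<pi> b. C $$ (i, j))) * (v $ b - v $ (l - 1))) +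
    ((\<Sum>b<l. M $$ (a, b)) - (\<Sum>j<n. C $$ (i, j))) * v $ (l - 1)"
proof -
  have "(C *\<^sub>v block_lift n l \<pi> v) $ i = (\<Sum>j<n. C $$ (i, j) * block_lift n l \<pi> v $ j)"
    by (rule index_mult_mat_vec_sum[OF C block_lift_carrier(1) \<open>i < m\<close>])
  also have "\<dots> = (\<Sum>b<l. \<Sum>j\<in>\<pi> b. C $$ (i, j) * block_lift n l \<pi> v $ j)"
    by (rule sum_over_blocks[OF part])
  also have "\<dots> = (\<Sum>b<l. (\<Sum>j\<in>\<pi> b. C $$ (i, j)) * v $ b)"
    by (intro sum.cong) (auto simp: sum_distrib_right index_block_lift[OF part])
  finally have "(M *\<^sub>v v) $ a - (C *\<^sub>v block_lift n l \<pi> v) $ i =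
      (\<Sum>b<l. (M $$ (a, b) - (\<Sum>j\<in>\<pi> b. C $$ (i, j))) * v $ b)"
    unfolding index_mult_mat_vec_sum[OF M v \<open>a < k\<close>] by (simp add: left_diff_distrib sum_subtractf)
  then show ?thesis
    unfolding summation_by_parts_last[OF \<open>0 < l\<close>] sum_over_blocks[OF part] sum_subtractf .
qed

locale rooted_block_bound =
  fixes l n :: nat and M C :: "real mat" and \<pi> :: "nat \<Rightarrow> nat set"
  assumes l_pos: "0 < l" and n_pos: "0 < n"
    and M_carrier: "M \<in> carrier_mat l l" and M_rooted: "rooted_mat M"
    and C_nonneg: "0\<^sub>m n n \<le> C"
    and partition: "indexed_partition n l \<pi>"
    and block_sum_le: "\<lbrakk>a < l; b < l - 1; i \<in> \<pi> a\<rbrakk> \<Longrightarrow> (\<Sum>j\<in>\<pi> b. C $$ (i, j)) \<le> M $$ (a, b)"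
    and row_sum_le: "\<lbrakk>a < l; i \<in> \<pi> a\<rbrakk> \<Longrightarrow> (\<Sum>j<n. C $$ (i, j)) \<le> (\<Sum>c<l. M $$ (a, c))"
begin

abbreviation lift :: "real vec \<Rightarrow> real vec" where
  "lift \<equiv> block_lift n l \<pi>"

lemma
  assumes v: "v \<in> carrier_vec l" "rooted_vec v" and a: "a < l" "i \<in> \<pi> a"
  shows lift_mult_le: "(C *\<^sub>v lift v) $ i \<le> (M *\<^sub>v v) $ a"
    and lift_mult_eq_iff: "(C *\<^sub>v lift v) $ i = (M *\<^sub>v v) $ a \<longleftrightarrow>
      (v $ (l - 1) \<noteq> 0 \<longrightarrow> (\<Sum>j<n. C $$ (i, j)) = (\<Sum>c<l. M $$ (a, c))) \<and>
      (\<forall>b<l - 1. v $ (l - 1) < v $ b \<longrightarrow> (\<Sum>j\<in>\<pi> b. C $$ (i, j)) = M $$ (a, b))"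
proof -
  have root: "\<And>b. b < l - 1 \<Longrightarrow> v $ (l - 1) \<le> v $ b" "0 \<le> v $ (l - 1)"
    using v by (auto simp: rooted_vec_def)
  let ?block_defect = "\<lambda>b. (M $$ (a, b) - (\<Sum>j\<in>\<pi> b. C $$ (i, j))) * (v $ b - v $ (l - 1))"
  let ?row_defect = "((\<Sum>c<l. M $$ (a, c)) - (\<Sum>j<n. C $$ (i, j))) * v $ (l - 1)"
  have "i < n" using indexed_partitionD(2)[OF partition a(1)] a(2) by auto
  then have defect: "(M *\<^sub>v v) $ a - (C *\<^sub>v lift v) $ i = (\<Sum>b<l - 1. ?block_defect b) + ?row_defect"
    by (rule block_lift_row_defect[OF l_pos partition M_carrier nonneg_matD(1)[OF C_nonneg]
          v(1) a(1)])
  have block_nonneg: "0 \<le> ?block_defect b" if "b < l - 1" for b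
    using block_sum_le[OF a(1) that a(2)] root(1)[OF that] by simp
  then have block_sum_nonneg: "0 \<le> (\<Sum>b<l - 1. ?block_defect b)" by (intro sum_nonneg) simp
  have row_nonneg: "0 \<le> ?row_defect" using row_sum_le[OF a] root(2) by simp
  show "(C *\<^sub>v lift v) $ i \<le> (M *\<^sub>v v) $ a" using defect block_sum_nonneg row_nonneg by linarith
  have "(C *\<^sub>v lift v) $ i = (M *\<^sub>v v) $ a \<longleftrightarrow> (\<Sum>b<l - 1. ?block_defect b) + ?row_defect = 0"
    using defect by linarith
  also have "\<dots> \<longleftrightarrow> (\<Sum>b<l - 1. ?block_defect b) = 0 \<and> ?row_defect = 0"
    by (rule add_nonneg_eq_0_iff[OF block_sum_nonneg row_nonneg])
  also have "(\<Sum>b<l - 1. ?block_defect b) = 0 \<longleftrightarrow> (\<forall>b<l - 1. ?block_defect b = 0)"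
    using block_nonneg by (subst sum_nonneg_eq_0_iff) auto
  also have "\<dots> \<longleftrightarrow> (\<forall>b<l - 1. v $ (l - 1) < v $ b \<longrightarrow> (\<Sum>j\<in>\<pi> b. C $$ (i, j)) = M $$ (a, b))"
    using root(1) by (fastforce simp: less_le)
  finally show "(C *\<^sub>v lift v) $ i = (M *\<^sub>v v) $ a \<longleftrightarrow>
      (v $ (l - 1) \<noteq> 0 \<longrightarrow> (\<Sum>j<n. C $$ (i, j)) = (\<Sum>c<l. M $$ (a, c))) \<and>
      (\<forall>b<l - 1. v $ (l - 1) < v $ b \<longrightarrow> (\<Sum>j\<in>\<pi> b. C $$ (i, j)) = M $$ (a, b))"
    by auto
qed

lemma strict_supersolution_lift:
  assumes "rooted_vec v" "strict_supersolution M c v"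
  shows "strict_supersolution C c (lift v)"
proof -
  note v = strict_supersolutionD[OF M_carrier assms(2)]
  have "(C *\<^sub>v lift v) $ i < c * lift v $ i" if "a < l" "i \<in> \<pi> a" for a i
    using lift_mult_le[OF v(1) assms(1) that] v(3)[OF that(1)]
    by (simp add: index_block_lift[OF partition that])
  then have "\<forall>i<n. (C *\<^sub>v lift v) $ i < c * lift v $ i"
    unfolding indexed_partition_all_iff[OF partition] by blast
  moreover have "\<forall>i<n. 0 < lift v $ i"
    using block_lift_all_iff[OF partition, of "\<lambda>x. 0 < x" v] v(2) by blast
  ultimately show ?thesis
    using nonneg_matD(1)[OF C_nonneg] by (simp add: strict_supersolution_def)
qed

lemma spectral_radius_le_largest_real_eigenvalue:
  "ereal (real_spectral_radius C) \<le> largest_real_eigenvalue M"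
proof -
  obtain \<mu> where \<mu>: "eigenvalue M \<mu>"
    and above: "\<And>c. \<mu> < c \<Longrightarrow> \<exists>v. rooted_vec v \<and> strict_supersolution M c v"
    using rooted_mat_eigenvalue[OF l_pos M_carrier M_rooted] by blast
  have "real_spectral_radius C \<le> c" if "\<mu> < c" for c
    using above[OF that] strict_supersolution_lift
      spectral_radius_less_if_strict_supersolution[OF n_pos C_nonneg] by (blast intro: less_imp_le)
  then have "real_spectral_radius C \<le> \<mu>" by (rule dense_ge)
  also have "\<mu> \<le> Max (spectrum M)"
    using \<mu> card_finite_spectrum(1)[OF M_carrier] by (simp add: spectrum_def)
  finally show ?thesis
    using \<mu> by (auto simp: largest_real_eigenvalue_def spectrum_def)
qed

lemma spectral_radius_eq_iff:
  assumes "eigenvector M u r" "rooted_vec u" "irreducible_mat C"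
  shows "real_spectral_radius C = r \<longleftrightarrow>
    (u $ (l - 1) \<noteq> 0 \<longrightarrow>
       (\<forall>a<l. \<forall>i\<in>\<pi> a. (\<Sum>j<n. C $$ (i, j)) = (\<Sum>c<l. M $$ (a, c)))) \<and>
    (\<forall>a<l. \<forall>b<l - 1. \<forall>i\<in>\<pi> a. u $ (l - 1) < u $ b \<longrightarrow>
       (\<Sum>j\<in>\<pi> b. C $$ (i, j)) = M $$ (a, b))"
proof -
  have u: "u \<in> carrier_vec l" "u \<noteq> 0\<^sub>v l" and Mu: "M *\<^sub>v u = r \<cdot>\<^sub>v u"
    using assms(1) M_carrier by (auto simp: eigenvector_def)
  note carrier = nonneg_matD(1)[OF C_nonneg]
  have r_lift: "r * lift u $ i = (M *\<^sub>v u) $ a" if "a < l" "i \<in> \<pi> a" for a i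
    using that u(1) by (simp add: Mu index_block_lift[OF partition that])
  have "\<forall>i<n. 0 \<le> lift u $ i"
    using block_lift_all_iff[OF partition, of "\<lambda>x. 0 \<le> x" u]
      rooted_vec_nonneg[OF assms(2)] u(1) by simp
  then have "0\<^sub>v n \<le> lift u" by (simp add: less_eq_vec_def)
  moreover have "\<not> (\<forall>i<n. lift u $ i = 0)"
    using block_lift_all_iff[OF partition, of "\<lambda>x. x = 0" u] u by (auto simp: vec_eq_iff)
  then have "lift u \<noteq> 0\<^sub>v n" by auto
  moreover have "\<forall>i<n. (C *\<^sub>v lift u) $ i \<le> r * lift u $ i"
    unfolding indexed_partition_all_iff[OF partition]
    using lift_mult_le[OF u(1) assms(2)] r_lift by simp
  then have "C *\<^sub>v lift u \<le> r \<cdot>\<^sub>v lift u"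
    using carrier by (simp add: less_eq_vec_def)
  ultimately have "real_spectral_radius C = r \<longleftrightarrow> C *\<^sub>v lift u = r \<cdot>\<^sub>v lift u"
    by (rule irreducible_spectral_radius_eq_iff[OF n_pos C_nonneg assms(3)])
  also have "\<dots> \<longleftrightarrow> (\<forall>i<n. (C *\<^sub>v lift u) $ i = r * lift u $ i)"
    using carrier by (auto simp: vec_eq_iff)
  also have "\<dots> \<longleftrightarrow> (\<forall>a<l. \<forall>i\<in>\<pi> a. (C *\<^sub>v lift u) $ i = (M *\<^sub>v u) $ a)"
    unfolding indexed_partition_all_iff[OF partition] using r_lift by simp
  finally show ?thesis
    using lift_mult_eq_iff[OF u(1) assms(2)] by simp blast
qed

end

lemma rooted_block_bound_if_Max_le:
  assumes "0 < l" "0 < n" "M \<in> carrier_mat l l" "rooted_mat M"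
    and "C \<in> carrier_mat n n" "\<forall>i<n. \<forall>j<n. 0 \<le> C $$ (i, j)"
    and partition: "indexed_partition n l \<pi>"
    and block_Max: "\<forall>a<l. \<forall>b<l - 1. Max ((\<lambda>i. \<Sum>j\<in>\<pi> b. C $$ (i, j)) ` \<pi> a) \<le> M $$ (a, b)"
    and row_Max: "\<forall>a<l. Max ((\<lambda>i. \<Sum>j<n. C $$ (i, j)) ` \<pi> a) \<le> (\<Sum>c<l. M $$ (a, c))"
  shows "rooted_block_bound l n M C \<pi>"
proof (unfold_locales; (fact assms)?)
  show "0\<^sub>m n n \<le> C" using assms by (auto simp: less_eq_mat_def)
next
  fix a b i assume "a < l" "b < l - 1" "i \<in> \<pi> a"
  then show "(\<Sum>j\<in>\<pi> b. C $$ (i, j)) \<le> M $$ (a, b)"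
    using block_Max indexed_partitionD[OF partition] by (simp add: Max_le_iff)
next
  fix a i assume "a < l" "i \<in> \<pi> a"
  then show "(\<Sum>j<n. C $$ (i, j)) \<le> (\<Sum>c<l. M $$ (a, c))"
    using row_Max indexed_partitionD[OF partition] by (simp add: Max_le_iff)
qed

theorem theorem5p1:
  fixes l n :: nat and M C :: "real mat" and \<pi> :: "nat \<Rightarrow> nat set"
  assumes "l > 0" and "n > 0"
    and "M \<in> carrier_mat l l" and "rooted_mat M"
    and "C \<in> carrier_mat n n" and "\<forall>i<n. \<forall>j<n. C $$ (i, j) \<ge> 0"
    and "indexed_partition n l \<pi>"
    and "\<forall>a<l. \<forall>b<l - 1. Max ((\<lambda>i. \<Sum>j\<in>\<pi> b. C $$ (i, j)) ` \<pi> a) \<le> M $$ (a, b)"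
    and "\<forall>a<l. Max ((\<lambda>i. \<Sum>j<n. C $$ (i, j)) ` \<pi> a) \<le> (\<Sum>c<l. M $$ (a, c))"
  shows "ereal (real_spectral_radius C) \<le> largest_real_eigenvalue M \<and>
    (\<forall>u r. ereal r = largest_real_eigenvalue M \<longrightarrow> eigenvector M u r \<longrightarrow> rooted_vec u \<longrightarrow>
       irreducible_mat C \<longrightarrow>
       (ereal (real_spectral_radius C) = largest_real_eigenvalue M \<longleftrightarrow>
          (u $ (l - 1) \<noteq> 0 \<longrightarrow>
             (\<forall>a<l. \<forall>i\<in>\<pi> a. (\<Sum>j<n. C $$ (i, j)) = (\<Sum>c<l. M $$ (a, c)))) \<and>
          (\<forall>a<l. \<forall>b<l - 1. \<forall>i\<in>\<pi> a. u $ b > u $ (l - 1) \<longrightarrow>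
             (\<Sum>j\<in>\<pi> b. C $$ (i, j)) = M $$ (a, b))))"
proof (intro conjI allI impI)
  interpret rooted_block_bound l n M C \<pi>
    using assms by (rule rooted_block_bound_if_Max_le)
  show "ereal (real_spectral_radius C) \<le> largest_real_eigenvalue M"
    by (rule spectral_radius_le_largest_real_eigenvalue)
  fix u r
  assume r: "ereal r = largest_real_eigenvalue M"
    and u: "eigenvector M u r" "rooted_vec u" and "irreducible_mat C"
  show "ereal (real_spectral_radius C) = largest_real_eigenvalue M \<longleftrightarrow>
      (u $ (l - 1) \<noteq> 0 \<longrightarrow>
         (\<forall>a<l. \<forall>i\<in>\<pi> a. (\<Sum>j<n. C $$ (i, j)) = (\<Sum>c<l. M $$ (a, c)))) \<and>
      (\<forall>a<l. \<forall>b<l - 1. \<forall>i\<in>\<pi> a. u $ b > u $ (l - 1) \<longrightarrow>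
         (\<Sum>j\<in>\<pi> b. C $$ (i, j)) = M $$ (a, b))"
    using spectral_radius_eq_iff[OF u \<open>irreducible_mat C\<close>] by (simp flip: r)
qed

end
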